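(* Let $d\ge 2$ and $k\le 5$ be positive integers, let $\xi_1,\dots,\xi_{k-1}\in\mathbb{C}\setminus\{0\}$, and let $l_1<l_2<\dots<l_{k-1}$ be positive integers. Assume that $P(T)\in\mathbb{C}[T]$ satisfies $P(0)=1$ and $$P(T)^d=1+\sum_{i=1}^{k-1}\xi_iT^{l_i}.$$ Then the following hold. (1) If $k=5$, one of the following holds: (a) $d=4$, $(l_2,l_3,l_4)=(2l_1,3l_1,4l_1)$, $\xi_2=\frac38\xi_1^2$, $\xi_3=\frac1{16}\xi_1^3$, $\xi_4=\frac1{256}\xi_1^4$, and $P(T)=1+\frac14\xi_1T^{l_1}$; (b) $d=3$, $(l_2,l_3,l_4)=(3l_1,5l_1,6l_1)$, $\xi_2=-\frac5{27}\xi_1^3$, $\xi_3=\frac1{81}\xi_1^5$, $\xi_4=-\frac1{729}\xi_1^6$, and $P(T)=1+\frac13\xi_1T^{l_1}-\frac19\xi_1^2T^{2l_1}$; (c) $d=2$, $(l_2,l_3,l_4)=(4l_1,5l_1,6l_1)$, $\xi_2=\frac5{64}\xi_1^4$, $\xi_3=-\frac1{64}\xi_1^5$, $\xi_4=\frac1{256}\xi_1^6$, and $P(T)=1+\frac12\xi_1T^{l_1}-\frac18\xi_1^2T^{2l_1}+\frac1{16}\xi_1^3T^{3l_1}$; (d) $d=2$, $(l_2,l_3,l_4)=(3l_1,5l_1,6l_1)$, $\xi_2=-\frac5{32}\xi_1^3$, $\xi_3=\frac1{256}\xi_1^5$, $\xi_4=\frac1{4096}\xi_1^6$, and $P(T)=1+\frac12\xi_1T^{l_1}-\frac18\xi_1^2T^{2l_1}-\frac1{64}\xi_1^3T^{3l_1}$;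 (e) $d=2$, $(l_2,l_3,l_4)=(4l_1,7l_1,8l_1)$, $\xi_2=\frac7{64}\xi_1^4$, $\xi_3=\frac1{512}\xi_1^7$, $\xi_4=\frac1{4096}\xi_1^8$, and $P(T)=1+\frac12\xi_1T^{l_1}-\frac18\xi_1^2T^{2l_1}+\frac1{16}\xi_1^3T^{3l_1}+\frac1{64}\xi_1^4T^{4l_1}$; (f) $d=2$, $(l_2,l_3,l_4)=(2l_1,5l_1,6l_1)$, $\xi_2=\frac54\xi_1^2$, $\xi_3=-\frac14\xi_1^5$, $\xi_4=\frac1{16}\xi_1^6$, and $P(T)=1+\frac12\xi_1T^{l_1}+\frac12\xi_1^2T^{2l_1}-\frac14\xi_1^3T^{3l_1}$; (g) $d=2$, $(l_2,l_3,l_4)=(2l_1,3l_1,4l_1)$, $\xi_3=-\frac18\xi_1^3+\frac12\xi_1\xi_2$, $\xi_4=\left(-\frac18\xi_1^2+\frac12\xi_2\right)^2$ (with $\xi_2$ free), and $P(T)=1+\frac12\xi_1T^{l_1}+\left(\frac12\xi_2-\frac18\xi_1^2\right)T^{2l_1}$. (2) If $k=4$, one of the following holds: (a) $d=2$, $(l_2,l_3)=(3l_1,4l_1)$, $\xi_2=-\frac18\xi_1^3$, $\xi_3=\frac1{64}\xi_1^4$, and $P(T)=1+\frac12\xi_1T^{l_1}-\frac18\xi_1^2T^{2l_1}$; (b) $d=3$, $(l_2,l_3)=(2l_1,3l_1)$, $\xi_2=\frac13\xi_1^2$, $\xi_3=\frac1{27}\xi_1^3$, and $P(T)=1+\frac13\xi_1T^{l_1}$.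 (3) If $k=3$, then $d=2$, $l_2=2l_1$, $\xi_2=\frac14\xi_1^2$, and $P(T)=1+\frac12\xi_1T^{l_1}$. *)

theory Defs
  imports Complex_Main "HOL-Computational_Algebra.Polynomial"
begin

end

theory Submission
  imports Defs
begin

text \<open>
Write \<open>Q = P ^ d\<close>, let \<open>N\<close> be the degree of \<open>P\<close>, so that \<open>Q\<close> has degree \<open>d N\<close>, and let \<open>a\<close> be
the least positive exponent of \<open>Q\<close>. The differential equation \<open>d P' Q = P Q'\<close>
(\<open>power_differential_equation\<close>) gives a recurrence between the coefficients of \<open>P\<close> and \<open>Q\<close>. Below
the second positive exponent of \<open>Q\<close> it has two terms only, and it says that \<open>P\<close> agrees there with the
binomial series of \<open>(1 + x T^a) ^ (1 / d)\<close>, where \<open>x\<close> is the coefficient of \<open>Q\<close> at \<open>a\<close>. In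
particular every multiple of \<open>a\<close> in that range is an exponent of \<open>P\<close>, and nothing else is.

If the second positive exponent of \<open>Q\<close> exceeds \<open>N\<close>, all of \<open>P\<close> is a truncated binomial series, say
with \<open>J + 1\<close> terms. Enough coefficients of \<open>Q\<close> just beyond the truncation are nonzero,
and so are the two highest ones (\<open>power_coeff_after_gap\<close>), so five terms suffice only for very
small \<open>J\<close> and \<open>d\<close> (\<open>power_exponents_after_gap\<close>). If instead \<open>Q\<close> has a gap of this kind at its
high end, the same applies to the reversed polynomials.

With at most five exponents, a gap is missing at both ends only if \<open>d = 2\<close> and the exponents of \<open>Q\<close>
are \<open>0 < a < N < c < 2 N\<close>. Then \<open>P\<close> is binomial from both ends, which forces equal steps at the two
ends (\<open>central_root\<close>), and three instances of the recurrence around \<open>N\<close> bound \<open>N / a\<close>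
(\<open>square_exponents_central\<close>). The resulting list of roots is \<open>sparse_root\<close>, the classification is
\<open>sparse_power_root\<close>, and the theorem follows by expanding the powers and comparing coefficients.
\<close>

section \<open>Coefficients of a polynomial and of its power\<close>

definition exponents :: "'a::zero poly \<Rightarrow> nat set" where
  "exponents p = {i. coeff p i \<noteq> 0}"

lemma finite_exponents [simp]: "finite (exponents p)"
  unfolding exponents_def by (rule finite_subset[of _ "{..degree p}"]) (auto simp: le_degree)

text \<open>This is the differential equation \<open>d P' Q = P Q'\<close> for \<open>Q = P ^ d\<close>, multiplied by the variable
and read off coefficientwise. It is linear in \<open>P\<close> for given \<open>Q\<close>, so a sparse \<open>Q\<close> turns it into
a recurrence with few terms. It replaces any use of the binomial series for the \<open>d\<close>-th root.\<close>

lemma power_differential_equation: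
  fixes p :: "'a::field_char_0 poly"
  shows "(\<Sum>i\<le>m. (of_nat d * of_nat (m - i) - of_nat i) * coeff (p ^ d) i * coeff p (m - i)) = 0"
proof -
  have euler: "coeff (pCons 0 (pderiv f)) i = of_nat i * coeff f i" for f :: "'a poly" and i
    by (cases i) (simp_all add: coeff_pderiv)
  have "pCons 0 (pderiv (p ^ d)) * p = smult (of_nat d) (p ^ d * pCons 0 (pderiv p))"
    by (cases d) (simp, simp add: pderiv_power_Suc mult_ac del: power_Suc, simp add: mult_ac)
  then have "coeff (pCons 0 (pderiv (p ^ d)) * p) m
      = coeff (smult (of_nat d) (p ^ d * pCons 0 (pderiv p))) m"
    by simp
  then have "(\<Sum>i\<le>m. of_nat i * coeff (p ^ d) i * coeff p (m - i))
      = of_nat d * (\<Sum>i\<le>m. coeff (p ^ d) i * (of_nat (m - i) * coeff p (m - i)))"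
    by (simp only: coeff_mult coeff_smult euler)
  then show ?thesis
    by (simp add: left_diff_distrib right_diff_distrib sum_subtractf sum_distrib_left mult_ac del: of_nat_diff)
qed

text \<open>In each application all but one, two or three of the products vanish, either because the exponent
does not occur in the power or because it exceeds the degree of the root.\<close>

lemma power_recurrence:
  fixes p :: "'a::field_char_0 poly"
  assumes "S \<subseteq> {..m}"
    and "\<And>i. i \<le> m \<Longrightarrow> i \<notin> S \<Longrightarrow> coeff (p ^ d) i = 0 \<or> coeff p (m - i) = 0"
  shows "(\<Sum>i\<in>S. (of_nat d * of_nat (m - i) - of_nat i) * coeff (p ^ d) i * coeff p (m - i)) = 0"
proof -
  have "(\<Sum>i\<in>S. (of_nat d * of_nat (m - i) - of_nat i) * coeff (p ^ d) i * coeff p (m - i))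
      = (\<Sum>i\<le>m. (of_nat d * of_nat (m - i) - of_nat i) * coeff (p ^ d) i * coeff p (m - i))"
    by (rule sum.mono_neutral_left) (use assms in auto)
  then show ?thesis
    by (simp only: power_differential_equation)
qed

lemma coeff_0_power_one: "coeff p 0 = 1 \<Longrightarrow> coeff (p ^ d) 0 = (1::'a::field_char_0)"
  by (simp add: coeff_0_power)

lemma root_coeff_step:
  fixes p :: "'a::field_char_0 poly"
  assumes "coeff p 0 = 1" "0 < a" "a \<le> m"
    and gap: "\<And>i. 0 < i \<Longrightarrow> i \<le> m \<Longrightarrow> i \<noteq> a \<Longrightarrow> coeff (p ^ d) i = 0"
  shows "of_nat d * of_nat m * coeff p m
    = (of_nat a - of_nat d * of_nat (m - a)) * coeff (p ^ d) a * coeff p (m - a)"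
proof -
  have "(\<Sum>i\<in>{0, a}. (of_nat d * of_nat (m - i) - of_nat i) * coeff (p ^ d) i * coeff p (m - i)) = 0"
    by (rule power_recurrence) (use assms in auto)
  then show ?thesis
    using assms(1,2) by (simp add: coeff_0_power_one algebra_simps)
qed

lemma root_coeff_zero:
  fixes p :: "'a::field_char_0 poly"
  assumes "coeff p 0 = 1" "0 < d" "0 < m"
    and gap: "\<And>i. 0 < i \<Longrightarrow> i \<le> m \<Longrightarrow> coeff (p ^ d) i = 0"
  shows "coeff p m = 0"
proof -
  have "(\<Sum>i\<in>{0}. (of_nat d * of_nat (m - i) - of_nat i) * coeff (p ^ d) i * coeff p (m - i)) = 0"
    by (rule power_recurrence) (use assms in auto)
  then show ?thesis
    using assms(1-3) by (simp add: coeff_0_power_one)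
qed

lemma of_nat_progression_nonzero:
  assumes "2 \<le> d" "0 < a"
  shows "(of_nat a - of_nat d * of_nat (j * a) :: 'a::field_char_0) \<noteq> 0"
proof
  assume "(of_nat a - of_nat d * of_nat (j * a) :: 'a) = 0"
  then have "(of_nat a :: 'a) = of_nat (d * (j * a))" by simp
  then have "1 * a = (d * j) * a" by (simp only: of_nat_eq_iff)
  then have "d * j = 1" using assms by (metis mult_right_cancel less_numeral_extra(3))
  then show False using assms by simp
qed

text \<open>Below the second positive exponent \<open>b\<close> of the power, the root agrees with the binomial series of
\<open>(1 + x T^a) ^ (1 / d)\<close>. Its exponents are the multiples of \<open>a\<close>, and all of them occur since
\<open>1 / d\<close> is not a natural number; in the recurrence this is the fact that
\<open>a - d j a\<close> never vanishes.\<close>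

lemma root_coeff_nonzero_iff:
  fixes p :: "'a::field_char_0 poly"
  assumes "2 \<le> d" "coeff p 0 = 1" "0 < a" "coeff (p ^ d) a \<noteq> 0"
    and gap: "\<And>i. 0 < i \<Longrightarrow> i < b \<Longrightarrow> i \<noteq> a \<Longrightarrow> coeff (p ^ d) i = 0"
    and "m < b"
  shows "coeff p m \<noteq> 0 \<longleftrightarrow> a dvd m"
  using \<open>m < b\<close>
proof (induction m rule: less_induct)
  case (less m)
  consider "m = 0" | "0 < m" "m < a" | "a \<le> m" by linarith
  then show ?case
  proof cases
    case 1
    then show ?thesis using assms by simp
  next
    case 2
    then have "coeff p m = 0"
      by (intro root_coeff_zero[of p d]) (use assms less.prems in auto)
    then show ?thesis using 2 by (auto dest: dvd_imp_le)
  next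
    case 3
    have step: "of_nat d * of_nat m * coeff p m
        = (of_nat a - of_nat d * of_nat (m - a)) * coeff (p ^ d) a * coeff p (m - a)"
      by (rule root_coeff_step) (use assms 3 less.prems in auto)
    have IH: "coeff p (m - a) \<noteq> 0 \<longleftrightarrow> a dvd m - a"
      using less.IH[of "m - a"] less.prems 3 assms(3) by auto
    have dvd: "a dvd m - a \<longleftrightarrow> a dvd m"
      using 3 by (metis dvd_diff_nat dvd_refl le_add_diff_inverse dvd_add_right_iff)
    have lhs: "of_nat d * of_nat m * coeff p m = 0 \<longleftrightarrow> coeff p m = 0"
      using assms(1,3) 3 by auto
    show ?thesis
    proof (cases "a dvd m")
      case True
      then obtain j where "m - a = j * a" using dvd by (metis dvdE mult.commute)
      then have "(of_nat a - of_nat d * of_nat (m - a) :: 'a) \<noteq> 0"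
        using of_nat_progression_nonzero[OF assms(1,3), of j] by simp
      then show ?thesis using step lhs IH dvd True assms(4) by auto
    next
      case False
      then show ?thesis using step lhs IH dvd by auto
    qed
  qed
qed

section \<open>Substituting a power of the variable\<close>

text \<open>If all exponents of a polynomial are multiples of \<open>a\<close>, it is a polynomial in \<open>T ^ a\<close>, and taking
powers and reversing the coefficients commute with this substitution. So the least positive
exponent can be normalised to 1.\<close>

lemma coeff_pcompose_monom:
  fixes p :: "'a::comm_ring_1 poly"
  assumes "0 < a"
  shows "coeff (pcompose p (monom 1 a)) i = (if a dvd i then coeff p (i div a) else 0)"
proof (induction p arbitrary: i)
  case 0
  then show ?case by simp
next
  case (pCons c p)
  have "coeff (monom 1 a * pcompose p (monom 1 a)) i
      = (if a \<le> i then coeff (pcompose p (monom 1 a)) (i - a) else 0)"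
    by (simp add: coeff_monom_mult)
  also have "\<dots> = (if a \<le> i then if a dvd i then coeff p ((i - a) div a) else 0 else 0)"
    using pCons.IH[of "i - a"] by (auto simp: dvd_minus_self)
  finally show ?case
    using assms
    by (auto simp: pcompose_pCons coeff_pCons dvd_imp_le le_div_geq div_eq_0_iff
        split: nat.splits dest: dvd_imp_le)
qed

lemma pcompose_power: "pcompose (p ^ n) r = pcompose p r ^ n" for p :: "'a::comm_ring_1 poly"
  by (induction n) (simp_all add: pcompose_mult pcompose_1)

lemma exponents_pcompose_monom:
  fixes p :: "'a::comm_ring_1 poly"
  assumes "0 < a"
  shows "exponents (pcompose p (monom 1 a)) = (*) a ` exponents p"
  using assms by (auto simp: exponents_def coeff_pcompose_monom image_iff)

lemma degree_pcompose_monom: "degree (pcompose p (monom 1 a)) = degree p * a"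
  for p :: "'a::field_char_0 poly"
  by (simp add: degree_pcompose degree_monom_eq)

lemma reflect_pcompose_monom:
  fixes p :: "'a::field_char_0 poly"
  assumes "0 < a"
  shows "reflect_poly (pcompose p (monom 1 a)) = pcompose (reflect_poly p) (monom 1 a)"
proof (rule poly_eqI)
  fix i
  show "coeff (reflect_poly (pcompose p (monom 1 a))) i
      = coeff (pcompose (reflect_poly p) (monom 1 a)) i"
  proof (cases "a dvd i")
    case True
    then obtain j where "i = a * j" by blast
    then show ?thesis using assms
      by (auto simp: coeff_reflect_poly degree_pcompose_monom coeff_pcompose_monom
          diff_mult_distrib mult.commute simp flip: diff_mult_distrib2)
  next
    case False
    then have "\<not> a dvd degree p * a - i" if "i \<le> degree p * a"
      using that by (metis dvd_diffD1 dvd_triv_right)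
    then show ?thesis using assms False
      by (auto simp: coeff_reflect_poly degree_pcompose_monom coeff_pcompose_monom)
  qed
qed

lemma pcompose_monom_exists:
  fixes P :: "'a::field_char_0 poly"
  assumes "0 < a" "\<And>i. coeff P i \<noteq> 0 \<Longrightarrow> a dvd i"
  obtains p where "P = pcompose p (monom 1 a)"
proof
  have fin: "\<forall>\<^sub>\<infinity>j. coeff P (a * j) = 0"
    unfolding MOST_nat
  proof (intro exI[of _ "degree P"] allI impI)
    fix j assume "degree P < j"
    also have "j \<le> a * j" using assms(1) by simp
    finally show "coeff P (a * j) = 0" by (rule coeff_eq_0)
  qed
  show "P = pcompose (Abs_poly (\<lambda>j. coeff P (a * j))) (monom 1 a)"
    by (rule poly_eqI) (use assms fin in \<open>auto simp: coeff_pcompose_monom Abs_poly_inverse\<close>)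
qed

section \<open>Powers of truncated binomial series\<close>

lemma truncated_root_coeffs_nonzero:
  fixes p :: "'a::field_char_0 poly"
  assumes "2 \<le> d" "coeff p 0 = 1" "coeff (p ^ d) 1 \<noteq> 0"
    and "\<And>i. 1 < i \<Longrightarrow> i \<le> degree p \<Longrightarrow> coeff (p ^ d) i = 0"
    and "m \<le> degree p"
  shows "coeff p m \<noteq> 0"
  using root_coeff_nonzero_iff[of d p 1 "degree p + 1" m] assms by auto

text \<open>The hypotheses say that \<open>p\<close> of degree \<open>J\<close> is the truncation of a binomial series with exponent
\<open>1 / d\<close>. The recurrence at the indices \<open>J + 1\<close>, \<open>J + 2\<close>, \<open>J + 3\<close> only sees the first coefficients
after the gap. It expresses each of them as a nonzero multiple of a known nonzero number, except
that the factor at \<open>J + 2\<close> is \<open>d - (J + 1)\<close>; when that vanishes, the factor at \<open>J + 3\<close> is \<open>d\<close>.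
The index \<open>d J - 1 + J\<close> sees only the two top coefficients.\<close>

lemma power_coeff_after_gap:
  fixes p :: "'a::field_char_0 poly"
  assumes "2 \<le> d" "coeff p 0 = 1" "0 < degree p" "coeff (p ^ d) 1 \<noteq> 0"
    and gap: "\<And>i. 1 < i \<Longrightarrow> i \<le> degree p \<Longrightarrow> coeff (p ^ d) i = 0"
  defines "J \<equiv> degree p"
  shows "coeff (p ^ d) (J + 1) \<noteq> 0"
    and "J + 1 \<noteq> d \<Longrightarrow> coeff (p ^ d) (J + 2) \<noteq> 0"
    and "J + 1 = d \<Longrightarrow> 2 \<le> J \<Longrightarrow> coeff (p ^ d) (J + 3) \<noteq> 0"
    and "coeff (p ^ d) (d * J - 1) \<noteq> 0"
proof -
  note nz = truncated_root_coeffs_nonzero[OF assms(1,2,4) gap]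
  have p0: "coeff p (J + k) = 0" if "0 < k" for k
    using that by (intro coeff_eq_0) (simp add: J_def)
  have q0: "coeff (p ^ d) i = 0" if "d * J < i" for i
    using that assms(2) by (intro coeff_eq_0, subst degree_power_eq) (auto simp: J_def)
  have dJ: "2 \<le> d * J"
    using mult_le_mono[of 2 d 1 J] assms(1,3) by (simp add: J_def)
  have "(\<Sum>i\<in>{1, J + 1}. (of_nat d * of_nat (J + 1 - i) - of_nat i) * coeff (p ^ d) i
      * coeff p (J + 1 - i)) = 0"
  proof (rule power_recurrence)
    fix i assume "i \<le> J + 1" "i \<notin> {1, J + 1}"
    then show "coeff (p ^ d) i = 0 \<or> coeff p (J + 1 - i) = 0"
      using gap[of i] p0[of 1] by (cases "i = 0") (auto simp: J_def)
  qed auto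
  then have e1: "(of_nat d * of_nat J - 1) * coeff (p ^ d) 1 * coeff p J
      = of_nat (J + 1) * coeff (p ^ d) (J + 1)"
    using assms(2,3) by (simp add: J_def algebra_simps)
  have "(of_nat d * of_nat J - 1 :: 'a) \<noteq> 0"
  proof
    assume "(of_nat d * of_nat J - 1 :: 'a) = 0"
    then have "(of_nat (d * J) :: 'a) = of_nat 1" by simp
    then show False using dJ by (simp only: of_nat_eq_iff)
  qed
  then show q1: "coeff (p ^ d) (J + 1) \<noteq> 0"
    using e1 nz[of J] assms(4) by (metis J_def mult_eq_0_iff order_refl)
  have "(\<Sum>i\<in>{J + 1, J + 2}. (of_nat d * of_nat (J + 2 - i) - of_nat i) * coeff (p ^ d) i
      * coeff p (J + 2 - i)) = 0"
  proof (rule power_recurrence)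
    fix i assume "i \<le> J + 2" "i \<notin> {J + 1, J + 2}"
    then show "coeff (p ^ d) i = 0 \<or> coeff p (J + 2 - i) = 0"
      using gap[of i] p0[of 1] p0[of 2] by (cases "i \<le> 1") (auto simp: J_def le_Suc_eq)
  qed auto
  then have e2: "(of_nat d - of_nat (J + 1)) * coeff (p ^ d) (J + 1) * coeff p 1
      = of_nat (J + 2) * coeff (p ^ d) (J + 2)"
    using assms(2) by (simp add: algebra_simps)
  have ne: "(of_nat d - of_nat (J + 1) :: 'a) = 0 \<longleftrightarrow> J + 1 = d"
    by (metis eq_iff_diff_eq_0 of_nat_eq_iff)
  show "coeff (p ^ d) (J + 2) \<noteq> 0" if "J + 1 \<noteq> d"
    using e2 ne that q1 nz[of 1] assms(3) by (metis One_nat_def Suc_leI mult_eq_0_iff)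
  show "coeff (p ^ d) (J + 3) \<noteq> 0" if "J + 1 = d" "2 \<le> J"
  proof -
    have "of_nat (J + 2) * coeff (p ^ d) (J + 2) = 0"
      unfolding e2[symmetric] using ne that(1) by simp
    then have q2: "coeff (p ^ d) (J + 2) = 0"
      by (metis add_2_eq_Suc' mult_eq_0_iff of_nat_eq_0_iff old.nat.distinct(1))
    have "(\<Sum>i\<in>{J + 1, J + 3}. (of_nat d * of_nat (J + 3 - i) - of_nat i) * coeff (p ^ d) i
        * coeff p (J + 3 - i)) = 0"
    proof (rule power_recurrence)
      fix i assume "i \<le> J + 3" "i \<notin> {J + 1, J + 3}"
      then show "coeff (p ^ d) i = 0 \<or> coeff p (J + 3 - i) = 0"
        using gap[of i] p0[of 2] p0[of 3] q2
        by (cases "i \<le> 1"; cases "i = J + 2") (auto simp: J_def le_Suc_eq numeral_3_eq_3)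
    qed auto
    moreover have "(of_nat d * of_nat 2 - of_nat (J + 1) :: 'a) = of_nat d"
      unfolding that(1) by simp
    ultimately have "of_nat d * coeff (p ^ d) (J + 1) * coeff p 2
        = of_nat (J + 3) * coeff (p ^ d) (J + 3)"
      using assms(2) by (simp add: algebra_simps)
    then show ?thesis
      using q1 nz[of 2] that(2) assms(1)
      by (metis J_def mult_eq_0_iff not_numeral_le_zero of_nat_eq_0_iff)
  qed
  obtain z where z: "d * J = z + 1"
    using dJ le_Suc_ex[of 1 "d * J"] by (metis add.commute one_le_numeral order_trans)
  have "(\<Sum>i\<in>{z, z + 1}. (of_nat d * of_nat (z + J - i) - of_nat i)
      * coeff (p ^ d) i * coeff p (z + J - i)) = 0"
  proof (rule power_recurrence)
    show "{z, z + 1} \<subseteq> {..z + J}" using assms(3) by (auto simp: J_def)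
    fix i assume "i \<le> z + J" "i \<notin> {z, z + 1}"
    then show "coeff (p ^ d) i = 0 \<or> coeff p (z + J - i) = 0"
      using q0[of i] p0[of "z - i"] z by (cases "z < i") (auto simp: add.commute)
  qed
  moreover have "z + J - (z + 1) = J - 1" by simp
  ultimately have "(of_nat d * of_nat J - of_nat z) * coeff (p ^ d) z * coeff p J
      + (of_nat d * of_nat (J - 1) - of_nat (z + 1)) * coeff (p ^ d) (z + 1) * coeff p (J - 1) = 0"
    by simp
  moreover have dJz: "(of_nat d * of_nat J :: 'a) = of_nat z + 1"
    using arg_cong[OF z, of "of_nat :: nat \<Rightarrow> 'a"] by simp
  moreover have "(of_nat d * of_nat (J - 1) :: 'a) = of_nat d * of_nat J - of_nat d"
    using assms(3) by (simp add: J_def of_nat_diff right_diff_distrib)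
  ultimately have e3: "coeff (p ^ d) z * coeff p J
      = of_nat d * coeff (p ^ d) (z + 1) * coeff p (J - 1)"
    by simp
  have "coeff (p ^ d) (d * J) = coeff p J ^ d"
    using lead_coeff_power[of p d] degree_power_eq[of p d] assms(3) by (force simp: J_def)
  then show "coeff (p ^ d) (d * J - 1) \<noteq> 0"
    using e3 z nz[of J] nz[of "J - 1"] assms(1) by (auto simp: J_def)
qed

text \<open>The power has the exponents \<open>0, 1, J + 1, J + 2, d J - 1, d J\<close>, with \<open>J + 3\<close> in place of \<open>J + 2\<close>
if \<open>J + 1 = d\<close> and \<open>J \<ge> 2\<close>. At most five exponents force two of these to coincide, so
\<open>d J - 1 \<le> J + 2\<close>, respectively \<open>d J - 1 \<le> J + 3\<close>. This leaves five pairs besides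
\<open>d = 2\<close>, \<open>J = 1\<close>, where neither alternative applies.\<close>

lemma power_exponents_after_gap:
  fixes p :: "'a::field_char_0 poly"
  assumes "2 \<le> d" "coeff p 0 = 1" "0 < degree p" "coeff (p ^ d) 1 \<noteq> 0"
    and gap: "\<And>i. 1 < i \<Longrightarrow> i \<le> degree p \<Longrightarrow> coeff (p ^ d) i = 0"
    and card: "card (exponents (p ^ d)) \<le> 5"
  shows "(d, degree p) \<in> {(2, 1), (3, 1), (4, 1), (2, 2), (2, 3), (3, 2)}"
proof -
  define J where "J = degree p"
  note * = power_coeff_after_gap[OF assms(1-4) gap, folded J_def]
  have top: "coeff (p ^ d) (d * J) \<noteq> 0"
    using lead_coeff_power[of p d] degree_power_eq[of p d] assms(3) by (force simp: J_def)
  have J: "0 < J" using assms(3) by (simp add: J_def)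
  have bound: "card X \<le> 5" if "X \<subseteq> exponents (p ^ d)" for X
    using card_mono[OF finite_exponents that] card by linarith
  obtain z where z: "d * J = z + 1"
    using J assms(1) less_imp_Suc_add[of 0 "d * J"] by auto
  have zero: "coeff (p ^ d) 0 \<noteq> 0" using assms(2) by (simp add: coeff_0_power)
  have dJ: "d * J - 1 \<le> J + 2" if "J + 1 \<noteq> d"
  proof (rule ccontr)
    assume "\<not> d * J - 1 \<le> J + 2"
    then have "J + 2 < z" using z by simp
    then have card: "card {0, 1, J + 1, J + 2, d * J - 1, d * J} = 6" unfolding z using J by simp
    have "{0, 1, J + 1, J + 2, d * J - 1, d * J} \<subseteq> exponents (p ^ d)"
      using *(1,2,4) top zero assms(4) that by (auto simp: exponents_def)
    from bound[OF this] card show False by linarith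
  qed
  have dJ': "d * J - 1 \<le> J + 3" if "J + 1 = d" "2 \<le> J"
  proof (rule ccontr)
    assume "\<not> d * J - 1 \<le> J + 3"
    then have "J + 3 < z" using z by simp
    then have card: "card {0, 1, J + 1, J + 3, d * J - 1, d * J} = 6" unfolding z using J by simp
    have "{0, 1, J + 1, J + 3, d * J - 1, d * J} \<subseteq> exponents (p ^ d)"
      using *(1,3,4) top zero assms(4) that by (auto simp: exponents_def)
    from bound[OF this] card show False by linarith
  qed
  \<comment> \<open>shifting the variables to their lower bounds leaves inequalities without subtraction\<close>
  obtain e where e: "d = e + 2" using assms(1) by (metis add.commute le_Suc_ex)
  obtain j where j: "J = j + 1" using J by (metis Suc_eq_plus1 gr0_implies_Suc)
  have "(d, J) \<in> {(2, 1), (3, 1), (4, 1), (2, 2), (2, 3), (3, 2)}"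
  proof (cases "J + 1 = d")
    case True
    then have "j = e" using e j by simp
    show ?thesis
    proof (cases "e = 0")
      case False
      then have "e * e + 3 * e + 1 \<le> e + 5"
        using dJ' True e j by (simp add: algebra_simps)
      then have "e < 2" using mult_le_mono[of 2 e 2 e] by linarith
      then show ?thesis using e j \<open>j = e\<close> False by auto
    qed (use e j \<open>j = e\<close> in auto)
  next
    case False
    then have le: "e * j + e + j \<le> 2" using dJ e j by (simp add: algebra_simps)
    then have "e \<le> 2" "j \<le> 2" by auto
    then have "e \<in> {0, 1, 2}" "j \<in> {0, 1, 2}" by auto
    then show ?thesis using le False e j by auto
  qed
  then show ?thesis by (simp add: J_def)
qed

text \<open>Here the middle exponent of the square equals the degree \<open>J\<close> of the root, so the top coefficient
\<open>p\<^sub>J\<close> and the middle coefficient \<open>q\<^sub>J\<close> are two unknowns beyond the binomial truncation. The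
recurrence at \<open>J\<close> and \<open>J + 1\<close> gives two linear relations between them, and at \<open>J + 2\<close> (if that
lies below \<open>2 J - 1\<close>) it reads \<open>(4 - J) q\<^sub>J p\<^sub>2 = 0\<close>, which pins down \<open>J\<close>.\<close>

lemma square_exponents_central:
  fixes p :: "'a::field_char_0 poly"
  assumes "coeff p 0 = 1" "coeff (p ^ 2) 1 \<noteq> 0" "3 \<le> degree p"
    and gap: "\<And>i. i \<notin> {0, 1, degree p, 2 * degree p - 1, 2 * degree p} \<Longrightarrow> coeff (p ^ 2) i = 0"
  defines "J \<equiv> degree p" and "x \<equiv> coeff p 1"
  shows "J = 3 \<and> coeff p 2 = - (x ^ 2 / 2) \<and> coeff p 3 = - (x ^ 3 / 8)
    \<or> J = 4 \<and> coeff p 2 = - (x ^ 2 / 2) \<and> coeff p 3 = x ^ 3 / 2 \<and> coeff p 4 = x ^ 4 / 4"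
proof -
  have p0: "coeff p i = 0" if "J < i" for i
    using that by (intro coeff_eq_0) (simp add: J_def)
  have J: "3 \<le> J" using assms by simp
  have gap: "coeff (p ^ 2) i = 0" if "i \<notin> {0, 1, J, 2 * J - 1, 2 * J}" for i
    using gap that by (simp add: J_def)
  have step: "of_nat m * coeff p m = (1 - 2 * of_nat (m - 1)) * x * coeff p (m - 1)"
    if "1 \<le> m" "m < J" for m
  proof -
    have *: "2 * of_nat m * coeff p m = (1 - 2 * of_nat (m - 1)) * coeff (p ^ 2) 1 * coeff p (m - 1)"
      if "1 \<le> m" "m < J" for m
      using root_coeff_step[of p 1 m 2] that assms(1) gap by force
    have "coeff (p ^ 2) 1 = 2 * x"
      using *[of 1] J assms(1) by (simp add: x_def)
    with *[OF that] show ?thesis by simp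
  qed
  have q1: "coeff (p ^ 2) 1 = 2 * x"
    using root_coeff_step[of p 1 1 2] J assms(1) gap by (simp add: x_def)
  have x: "x \<noteq> 0" using q1 assms(2) by auto
  have p2: "coeff p 2 = - (x ^ 2 / 2)"
    using step[of 2] J by (simp add: x_def power2_eq_square field_simps)
  have "(\<Sum>i\<in>{0, 1, J}. (of_nat 2 * of_nat (J - i) - of_nat i) * coeff (p ^ 2) i
      * coeff p (J - i)) = 0"
    by (rule power_recurrence) (use gap J in auto)
  then have r0: "2 * of_nat J * coeff p J + (2 * of_nat (J - 1) - 1) * (2 * x) * coeff p (J - 1)
      = of_nat J * coeff (p ^ 2) J"
    using J assms(1) q1 by (simp add: coeff_0_power algebra_simps)
  have "(\<Sum>i\<in>{1, J}. (of_nat 2 * of_nat (J + 1 - i) - of_nat i) * coeff (p ^ 2) i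
      * coeff p (J + 1 - i)) = 0"
  proof (rule power_recurrence)
    fix i assume "i \<le> J + 1" "i \<notin> {1, J}"
    then show "coeff (p ^ 2) i = 0 \<or> coeff p (J + 1 - i) = 0"
      using gap[of i] p0[of "J + 1"] J by (cases "i = 0") auto
  qed (use J in auto)
  then have "(2 * of_nat J - 1) * (2 * x) * coeff p J = (of_nat J - 2) * coeff (p ^ 2) J * x"
    using J q1 by (simp add: x_def algebra_simps)
  then have r1: "(2 * of_nat J - 1) * 2 * coeff p J = (of_nat J - 2) * coeff (p ^ 2) J"
    using x by (metis (no_types, lifting) mult.assoc mult.commute mult_right_cancel)
  have qJ: "coeff (p ^ 2) J \<noteq> 0"
  proof
    assume "coeff (p ^ 2) J = 0"
    then have "(2 * of_nat J - 1 :: 'a) = 0"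
      using r1 assms(3) by (auto simp: J_def)
    then have "(of_nat (2 * J) :: 'a) = of_nat 1" by simp
    then show False using J by (simp only: of_nat_eq_iff)
  qed
  show ?thesis
  proof (cases "J = 3")
    case True
    then have "coeff (p ^ 2) 3 = 10 * coeff p 3" using r1 by simp
    then have "24 * coeff p 3 = 6 * x * coeff p 2" using r0 True by (simp add: algebra_simps)
    then show ?thesis using True p2 by (simp add: power2_eq_square power3_eq_cube field_simps)
  next
    case False
    then have J4: "4 \<le> J" using J by simp
    have "(\<Sum>i\<in>{J}. (of_nat 2 * of_nat (J + 2 - i) - of_nat i) * coeff (p ^ 2) i
        * coeff p (J + 2 - i)) = 0"
    proof (rule power_recurrence)
      fix i assume "i \<le> J + 2" "i \<notin> {J}"
      then have "i \<le> 1 \<or> i \<notin> {0, 1, J, 2 * J - 1, 2 * J}" using J4 by auto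
      then show "coeff (p ^ 2) i = 0 \<or> coeff p (J + 2 - i) = 0"
        using gap[of i] p0[of "J + 2"] p0[of "J + 1"] J4 by (cases "i \<le> 1") (auto simp: le_Suc_eq)
    qed auto
    then have "(of_nat 4 :: 'a) = of_nat J" using qJ p2 x by simp
    then have J: "J = 4" by (simp only: of_nat_eq_iff)
    have p3: "coeff p 3 = x ^ 3 / 2"
      using step[of 3] J p2 by (simp add: power2_eq_square power3_eq_cube field_simps)
    have "coeff (p ^ 2) 4 = 7 * coeff p 4" using r1 J by simp
    then have "20 * coeff p 4 = 10 * x * coeff p 3" using r0 J by (simp add: algebra_simps)
    then show ?thesis using J p2 p3 by (simp add: power4_eq_xxxx power3_eq_cube field_simps)
  qed
qed

section \<open>The list of roots and its symmetry\<close>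

text \<open>The nonconstant \<open>p\<close> with constant coefficient 1 whose power \<open>p ^ d\<close> has at most five terms, up
to substituting a power of the variable.
The family \<open>quadratic_square\<close> covers both the four-term squares (\<open>\<alpha>\<^sup>2 + 2 \<beta> = 0\<close>) and the
one-parameter family of five-term squares.\<close>

inductive sparse_root :: "nat \<Rightarrow> 'a::field_char_0 poly \<Rightarrow> bool" where
  linear: "\<alpha> \<noteq> 0 \<Longrightarrow> d \<in> {2, 3, 4} \<Longrightarrow> sparse_root d [:1, \<alpha>:]"
| quadratic_square: "\<alpha> \<noteq> 0 \<Longrightarrow> \<beta> \<noteq> 0 \<Longrightarrow> sparse_root 2 [:1, \<alpha>, \<beta>:]"
| quadratic_cube: "\<alpha> \<noteq> 0 \<Longrightarrow> sparse_root 3 [:1, \<alpha>, - (\<alpha> ^ 2):]"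
| cubic_low: "\<alpha> \<noteq> 0 \<Longrightarrow> sparse_root 2 [:1, \<alpha>, - (\<alpha> ^ 2 / 2), \<alpha> ^ 3 / 2:]"
| cubic_high: "\<alpha> \<noteq> 0 \<Longrightarrow> sparse_root 2 [:1, \<alpha>, 2 * \<alpha> ^ 2, - (2 * \<alpha> ^ 3):]"
| cubic_central: "\<alpha> \<noteq> 0 \<Longrightarrow> sparse_root 2 [:1, \<alpha>, - (\<alpha> ^ 2 / 2), - (\<alpha> ^ 3 / 8):]"
| quartic: "\<alpha> \<noteq> 0 \<Longrightarrow> sparse_root 2 [:1, \<alpha>, - (\<alpha> ^ 2 / 2), \<alpha> ^ 3 / 2, \<alpha> ^ 4 / 4:]"

text \<open>The division by the leading coefficient makes the constant coefficient 1 again, so that on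
polynomials with constant coefficient 1 this is an involution preserving degrees.\<close>

definition reversal :: "'a::field poly \<Rightarrow> 'a poly" where
  "reversal p = smult (1 / lead_coeff p) (reflect_poly p)"

text \<open>Reversal exchanges the two cubics \<open>cubic_low\<close> and \<open>cubic_high\<close> and preserves each of the other
families; only the parameters change.\<close>

lemma sparse_root_reversal:
  assumes "sparse_root d p"
  shows "sparse_root d (reversal p)"
  using assms
proof cases
  case (linear \<alpha>)
  then show ?thesis
    using sparse_root.linear[of "1 / \<alpha>" d]
    by (simp add: reversal_def reflect_poly_def cCons_def)
next
  case (quadratic_square \<alpha> \<beta>)
  then show ?thesis
    using sparse_root.quadratic_square[of "\<alpha> / \<beta>" "1 / \<beta>"]
    by (simp add: reversal_def reflect_poly_def cCons_def)
next
  case (quadratic_cube \<alpha>)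
  then show ?thesis
    using sparse_root.quadratic_cube[of "- (1 / \<alpha>)"]
    by (simp add: reversal_def reflect_poly_def cCons_def field_simps eval_nat_numeral)
next
  case (cubic_low \<alpha>)
  then show ?thesis
    using sparse_root.cubic_high[of "- (1 / \<alpha>)"]
    by (simp add: reversal_def reflect_poly_def cCons_def field_simps eval_nat_numeral)
next
  case (cubic_high \<alpha>)
  then show ?thesis
    using sparse_root.cubic_low[of "- (1 / \<alpha>)"]
    by (simp add: reversal_def reflect_poly_def cCons_def field_simps eval_nat_numeral)
next
  case (cubic_central \<alpha>)
  then show ?thesis
    using sparse_root.cubic_central[of "4 / \<alpha>"]
    by (simp add: reversal_def reflect_poly_def cCons_def field_simps eval_nat_numeral)
next
  case (quartic \<alpha>)
  then show ?thesis
    using sparse_root.quartic[of "2 / \<alpha>"]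
    by (simp add: reversal_def reflect_poly_def cCons_def field_simps eval_nat_numeral)
qed

lemma poly_eq_coeff_list: "degree p \<le> n \<Longrightarrow> p = Poly (map (coeff p) [0..<Suc n])"
  by (intro poly_eqI) (auto simp: nth_default_def coeff_eq_0 simp del: upt_Suc)

lemma coeff_reversal:
  "coeff (reversal p) i = (if i \<le> degree p then coeff p (degree p - i) / lead_coeff p else 0)"
  by (simp add: reversal_def coeff_reflect_poly)

context
  fixes P :: "'a::field_char_0 poly"
  assumes P0: "coeff P 0 = 1"
begin

lemma lead_coeff_nonzero: "lead_coeff P \<noteq> 0"
  using P0 by auto

lemma degree_reversal: "degree (reversal P) = degree P"
  using P0 lead_coeff_nonzero by (simp add: reversal_def)

lemma coeff_0_reversal: "coeff (reversal P) 0 = 1"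
  using lead_coeff_nonzero by (simp add: coeff_reversal)

lemma reversal_reversal: "reversal (reversal P) = P"
proof (rule poly_eqI)
  fix i
  show "coeff (reversal (reversal P)) i = coeff P i"
    using P0 lead_coeff_nonzero degree_reversal
    by (auto simp: coeff_reversal[of "reversal P"] coeff_reversal[of P] coeff_eq_0)
qed

lemma reversal_power: "reversal (P ^ d) = reversal P ^ d"
  by (simp add: reversal_def reflect_poly_power smult_power lead_coeff_power power_one_over)

lemma exponents_reversal: "exponents (reversal P) = (\<lambda>i. degree P - i) ` exponents P"
proof (intro equalityI subsetI)
  fix i assume "i \<in> exponents (reversal P)"
  then have "i \<le> degree P" "coeff P (degree P - i) \<noteq> 0"
    by (auto simp: exponents_def coeff_reversal split: if_splits)
  then show "i \<in> (\<lambda>i. degree P - i) ` exponents P"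
    by (intro image_eqI[of _ _ "degree P - i"]) (auto simp: exponents_def)
next
  fix i assume "i \<in> (\<lambda>i. degree P - i) ` exponents P"
  then obtain j where "i = degree P - j" "coeff P j \<noteq> 0" by (auto simp: exponents_def)
  then show "i \<in> exponents (reversal P)"
    using lead_coeff_nonzero le_degree[of P j] by (simp add: exponents_def coeff_reversal)
qed

end

lemma reversal_pcompose_monom:
  fixes p :: "'a::field_char_0 poly"
  assumes "0 < a"
  shows "reversal (pcompose p (monom 1 a)) = pcompose (reversal p) (monom 1 a)"
  using assms by (simp add: reversal_def reflect_pcompose_monom pcompose_smult
      degree_pcompose_monom coeff_pcompose_monom)

section \<open>Classification of the roots of sparse powers\<close>

text \<open>If the power has no exponent up to the degree of the root besides 0 and \<open>a\<close>, then the root is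
determined by its coefficient at \<open>a\<close>: it is a truncated binomial series in \<open>T ^ a\<close>. The degrees
that remain are so small that its coefficients can be computed from the recurrence.\<close>

lemma low_gap_root:
  fixes P :: "'a::field_char_0 poly"
  assumes d: "2 \<le> d" and P0: "coeff P 0 = 1" and N: "0 < degree P"
    and a: "0 < a" "coeff (P ^ d) a \<noteq> 0"
    and gap: "\<And>i. 0 < i \<Longrightarrow> i \<le> degree P \<Longrightarrow> i \<noteq> a \<Longrightarrow> coeff (P ^ d) i = 0"
    and card: "card (exponents (P ^ d)) \<le> 5"
  shows "\<exists>p. P = pcompose p (monom 1 a) \<and> sparse_root d p"
proof -
  have "a dvd m" if "coeff P m \<noteq> 0" for m
    using root_coeff_nonzero_iff[OF d P0 a, of "degree P + 1" m] gap that le_degree[OF that]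
    by simp
  then obtain p where P: "P = pcompose p (monom 1 a)"
    using pcompose_monom_exists a by metis
  have Pd: "P ^ d = pcompose (p ^ d) (monom 1 a)" by (simp add: P pcompose_power)
  have deg: "degree P = degree p * a" by (simp add: P degree_pcompose_monom)
  have Q: "coeff (p ^ d) i = coeff (P ^ d) (a * i)" for i
    using a by (simp add: Pd coeff_pcompose_monom)
  have p0: "coeff p 0 = 1" using P0 coeff_pcompose_monom[OF a(1), of p 0] by (simp add: P)
  have J: "0 < degree p" using N deg by simp
  have q1_nz: "coeff (p ^ d) 1 \<noteq> 0" using a by (simp add: Q)
  have gap': "coeff (p ^ d) i = 0" if "1 < i" "i \<le> degree p" for i
    unfolding Q by (rule gap) (use that a deg in \<open>auto simp: mult.commute\<close>)
  have "card (exponents (p ^ d)) = card (exponents (P ^ d))"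
    unfolding Pd exponents_pcompose_monom[OF a(1)]
    by (rule card_image[symmetric]) (use a in \<open>auto simp: inj_on_def\<close>)
  then have cases: "(d, degree p) \<in> {(2, 1), (3, 1), (4, 1), (2, 2), (2, 3), (3, 2)}"
    by (intro power_exponents_after_gap d p0 J q1_nz gap') (use card in auto)
  define \<alpha> where "\<alpha> = coeff p 1"
  have step: "of_nat d * of_nat m * coeff p m
      = (1 - of_nat d * of_nat (m - 1)) * coeff (p ^ d) 1 * coeff p (m - 1)"
    if "1 \<le> m" "m \<le> degree p" for m
    using root_coeff_step[of p 1 m d] gap' p0 that by force
  have q1: "coeff (p ^ d) 1 = of_nat d * \<alpha>"
    using step[of 1] J p0 by (simp add: \<alpha>_def)
  have step: "of_nat m * coeff p m = (1 - of_nat d * of_nat (m - 1)) * \<alpha> * coeff p (m - 1)"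
    if "1 \<le> m" "m \<le> degree p" for m
  proof -
    have "of_nat d * (of_nat m * coeff p m)
        = of_nat d * ((1 - of_nat d * of_nat (m - 1)) * \<alpha> * coeff p (m - 1))"
      using step[OF that] unfolding q1 by (simp only: mult_ac)
    then show ?thesis using d by (simp del: of_nat_diff)
  qed
  have \<alpha>: "\<alpha> \<noteq> 0" using q1 q1_nz by (metis mult_zero_right)
  note p = poly_eq_coeff_list[OF order_refl, of p]
  from cases consider "d \<in> {2, 3, 4}" "degree p = 1" | "d = 2" "degree p = 2"
    | "d = 2" "degree p = 3" | "d = 3" "degree p = 2" by auto
  then have "sparse_root d p"
  proof cases
    case 1
    have "p = [:1, \<alpha>:]" using p 1 p0 by (simp add: \<alpha>_def)
    then show ?thesis using sparse_root.linear[OF \<alpha>, of d] 1 by simp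
  next
    case 2
    have "coeff p 2 \<noteq> 0" using 2 by (metis leading_coeff_0_iff degree_0 zero_neq_numeral)
    moreover have "p = [:1, \<alpha>, coeff p 2:]"
      using p 2 p0 by (simp add: \<alpha>_def numeral_2_eq_2)
    ultimately show ?thesis using sparse_root.quadratic_square[OF \<alpha>, of "coeff p 2"] 2 by simp
  next
    case 3
    have p2: "coeff p 2 = - (\<alpha> ^ 2 / 2)"
      using step[of 2] 3 by (simp add: \<alpha>_def power2_eq_square field_simps)
    have p3: "coeff p 3 = \<alpha> ^ 3 / 2"
      using step[of 3] 3 p2 by (simp add: power2_eq_square power3_eq_cube field_simps)
    have "p = [:1, \<alpha>, coeff p 2, coeff p 3:]"
      using p 3 p0 by (simp add: \<alpha>_def numeral_2_eq_2 numeral_3_eq_3)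
    then show ?thesis using sparse_root.cubic_low[OF \<alpha>] 3 p2 p3 by simp
  next
    case 4
    have p2: "coeff p 2 = - (\<alpha> ^ 2)"
      using step[of 2] 4 by (simp add: \<alpha>_def power2_eq_square field_simps)
    have "p = [:1, \<alpha>, coeff p 2:]"
      using p 4 p0 by (simp add: \<alpha>_def numeral_2_eq_2)
    then show ?thesis using sparse_root.quadratic_cube[OF \<alpha>] 4 p2 by simp
  qed
  with P show ?thesis by blast
qed

text \<open>The multiples of \<open>a\<close>, counted from 0, and those of \<open>e\<close>, counted down from \<open>N\<close>, can only give the
same set between 0 and \<open>N\<close> if the steps agree: if, say, \<open>a < e\<close>, then \<open>a\<close> and \<open>2 a\<close> both lie in
the set, at a distance less than \<open>e\<close>.\<close>

lemma matching_progressions: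
  fixes a e N :: nat
  assumes "0 < a" "0 < e" "a < N" "e < N"
    and iff: "\<And>m. 0 < m \<Longrightarrow> m < N \<Longrightarrow> a dvd m \<longleftrightarrow> e dvd N - m"
  shows "a = e \<and> a dvd N"
proof -
  have e: "e dvd N - a" using iff[of a] assms by simp
  have a: "a dvd N - e" using iff[of "N - e"] assms by simp
  have "\<not> a < e"
  proof
    assume "a < e"
    moreover have "e \<le> N - a" using e assms by (intro dvd_imp_le) auto
    ultimately have "2 * a < N" by linarith
    then have "e dvd N - 2 * a" using iff[of "2 * a"] assms by simp
    then have "e dvd (N - a) - (N - 2 * a)" using e by (rule dvd_diff_nat[rotated])
    moreover have "(N - a) - (N - 2 * a) = a" using \<open>2 * a < N\<close> by simp
    ultimately show False using \<open>a < e\<close> assms(1) by (auto dest: dvd_imp_le)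
  qed
  moreover have "\<not> e < a"
  proof
    assume "e < a"
    moreover have "a \<le> N - e" using a assms by (intro dvd_imp_le) auto
    ultimately have "2 * e < N" by linarith
    then have "a dvd N - 2 * e" using iff[of "N - 2 * e"] assms by simp
    then have "a dvd (N - e) - (N - 2 * e)" using a by (rule dvd_diff_nat[rotated])
    moreover have "(N - e) - (N - 2 * e) = e" using \<open>2 * e < N\<close> by simp
    ultimately show False using \<open>e < a\<close> assms(2) by (auto dest: dvd_imp_le)
  qed
  ultimately have "a = e" by simp
  then show ?thesis
    using dvd_diffD[of a N a] e assms(3) by simp
qed

text \<open>If the middle exponent of the square is the degree \<open>N\<close> of the root, neither end of the square
determines the root completely: the low end determines the coefficients below \<open>N\<close>, the high end those
above 0. Comparing the two descriptions of the set of exponents shows that the root is still a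
polynomial in \<open>T ^ a\<close>.\<close>

lemma central_root:
  fixes P :: "'a::field_char_0 poly"
  assumes P0: "coeff P 0 = 1"
    and order: "0 < a" "a < degree P" "degree P < c" "c < 2 * degree P"
    and exps: "exponents (P ^ 2) = {0, a, degree P, c, 2 * degree P}"
  shows "\<exists>p. P = pcompose p (monom 1 a) \<and> sparse_root 2 p"
proof -
  define N where "N = degree P"
  define e where "e = 2 * N - c"
  note order = order[folded N_def] and exps = exps[folded N_def]
  have mem: "coeff (P ^ 2) i = 0 \<longleftrightarrow> i \<notin> {0, a, N, c, 2 * N}" for i
    using exps unfolding exponents_def by blast
  have degQ: "degree (P ^ 2) = 2 * N"
    using P0 by (subst degree_power_eq) (auto simp: N_def)
  have low: "coeff P m \<noteq> 0 \<longleftrightarrow> a dvd m" if "m < N" for m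
    by (rule root_coeff_nonzero_iff[where d = 2 and b = N])
      (use P0 order mem that in auto)
  have exps_rev: "exponents (reversal P ^ 2) = {0, e, N, 2 * N - a, 2 * N}"
  proof -
    have "exponents (reversal P ^ 2) = (\<lambda>i. 2 * N - i) ` exponents (P ^ 2)"
      using exponents_reversal[of "P ^ 2"] reversal_power[OF P0, of 2] P0 degQ
      by (simp add: coeff_0_power)
    then show ?thesis unfolding exps by (auto simp: e_def)
  qed
  then have mem_rev: "coeff (reversal P ^ 2) i = 0 \<longleftrightarrow> i \<notin> {0, e, N, 2 * N - a, 2 * N}" for i
    unfolding exponents_def by blast
  have e: "0 < e" "e < N" using order by (auto simp: e_def)
  have high: "coeff (reversal P) m \<noteq> 0 \<longleftrightarrow> e dvd m" if "m < N" for m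
    by (rule root_coeff_nonzero_iff[where d = 2 and b = N])
      (use coeff_0_reversal[OF P0] order e mem_rev that in auto)
  have "a dvd m \<longleftrightarrow> e dvd N - m" if "0 < m" "m < N" for m
  proof -
    have "coeff (reversal P) (N - m) \<noteq> 0 \<longleftrightarrow> coeff P m \<noteq> 0"
      using that lead_coeff_nonzero[OF P0] by (simp add: coeff_reversal N_def)
    then show ?thesis using low[of m] high[of "N - m"] that by simp
  qed
  then have ae: "a = e" "a dvd N"
    using matching_progressions[of a e N] order e by auto
  have "a dvd m" if "coeff P m \<noteq> 0" for m
    using low[of m] ae(2) le_degree[OF that] that by (cases "m = N") (auto simp: N_def)
  then obtain p where P: "P = pcompose p (monom 1 a)"
    using pcompose_monom_exists order(1) by metis
  define J where "J = degree p"
  have N: "N = J * a" by (simp add: P N_def J_def degree_pcompose_monom)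
  have J: "2 \<le> J" using order N by (cases "J = 0 \<or> J = 1") auto
  have c: "c = 2 * N - a" using ae e by (simp add: e_def)
  have q: "coeff (p ^ 2) i = coeff (P ^ 2) (a * i)" for i
    using order by (simp add: P coeff_pcompose_monom flip: pcompose_power)
  have p: "coeff p i = coeff P (a * i)" for i
    using order by (simp add: P coeff_pcompose_monom)
  have p0: "coeff p 0 = 1" using P0 by (simp add: p)
  have p1: "coeff p 1 \<noteq> 0" using low[of a] order by (simp add: p)
  have "sparse_root 2 p"
  proof (cases "J = 2")
    case True
    have "coeff p 2 \<noteq> 0"
      using True by (metis J_def leading_coeff_0_iff degree_0 zero_neq_numeral)
    moreover have "p = [:1, coeff p 1, coeff p 2:]"
      using poly_eq_coeff_list[OF order_refl, of p] True p0 by (simp add: J_def numeral_2_eq_2)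
    ultimately show ?thesis using sparse_root.quadratic_square[OF p1, of "coeff p 2"] by simp
  next
    case False
    define x where "x = coeff p 1"
    have "J = 3 \<and> coeff p 2 = - (x ^ 2 / 2) \<and> coeff p 3 = - (x ^ 3 / 8)
      \<or> J = 4 \<and> coeff p 2 = - (x ^ 2 / 2) \<and> coeff p 3 = x ^ 3 / 2 \<and> coeff p 4 = x ^ 4 / 4"
      unfolding J_def x_def
    proof (rule square_exponents_central)
      show "coeff (p ^ 2) 1 \<noteq> 0" using exps by (auto simp: q exponents_def)
      show "3 \<le> degree p" using False J by (simp add: J_def)
      fix i assume i: "i \<notin> {0, 1, degree p, 2 * degree p - 1, 2 * degree p}"
      have "a * i \<notin> (*) a ` {0, 1, J, 2 * J - 1, 2 * J}"
        using i order(1) by (auto simp: J_def)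
      moreover have "(*) a ` {0, 1, J, 2 * J - 1, 2 * J} = exponents (P ^ 2)"
        unfolding exps c N by (simp add: mult_ac diff_mult_distrib2)
      ultimately show "coeff (p ^ 2) i = 0" unfolding q exponents_def by blast
    qed (rule p0)
    then show ?thesis
    proof (elim disjE conjE)
      assume c: "J = 3" "coeff p 2 = - (x ^ 2 / 2)" "coeff p 3 = - (x ^ 3 / 8)"
      have "p = [:1, x, coeff p 2, coeff p 3:]"
        using poly_eq_coeff_list[OF order_refl, of p] c(1) p0
        by (simp add: J_def x_def numeral_2_eq_2 numeral_3_eq_3)
      then show ?thesis using sparse_root.cubic_central[of x] p1 c(2,3) by (simp add: x_def)
    next
      assume c: "J = 4" "coeff p 2 = - (x ^ 2 / 2)" "coeff p 3 = x ^ 3 / 2" "coeff p 4 = x ^ 4 / 4"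
      have "p = [:1, x, coeff p 2, coeff p 3, coeff p 4:]"
        using poly_eq_coeff_list[OF order_refl, of p] c(1) p0
        by (simp add: J_def x_def eval_nat_numeral)
      then show ?thesis using sparse_root.quartic[of x] p1 c(2-4) by (simp add: x_def)
    qed
  qed
  with P show ?thesis by blast
qed

text \<open>Let \<open>a\<close> and \<open>c\<close> be the second smallest and the second largest exponent of the power, whose degree is
\<open>n = d N\<close>. If some exponent \<open>i \<le> N\<close> other than \<open>0, a\<close> and some exponent \<open>j \<ge> n - N\<close> other than
\<open>c, n\<close> exist, then \<open>a < i \<le> j < c\<close> because \<open>2 N \<le> n\<close>; five exponents leave room only for
\<open>i = j\<close>, so \<open>N = n - N\<close> and \<open>d = 2\<close>. Otherwise there is a gap at the low end, or at the high end,
and the latter is a gap at the low end of the reversed power.\<close>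

lemma sparse_power_root:
  fixes P :: "'a::field_char_0 poly"
  assumes d: "2 \<le> d" and P0: "coeff P 0 = 1" and "0 < degree P"
    and card: "card (exponents (P ^ d)) \<le> 5"
  shows "\<exists>a p. 0 < a \<and> P = pcompose p (monom 1 a) \<and> sparse_root d p"
proof -
  define N where "N = degree P"
  define n where "n = d * N"
  define E where "E = exponents (P ^ d)"
  have degQ: "degree (P ^ d) = n"
    using assms(3) by (subst degree_power_eq) (auto simp: n_def N_def)
  have n: "2 * N \<le> n" "0 < N" using d assms(3) by (auto simp: n_def N_def)
  have Q0: "coeff (P ^ d) 0 = 1" using P0 by (simp add: coeff_0_power)
  have mem: "i \<in> E \<longleftrightarrow> coeff (P ^ d) i \<noteq> 0" for i
    by (simp add: E_def exponents_def)
  have le: "i \<le> n" if "i \<in> E" for i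
    using that le_degree[of "P ^ d" i] degQ by (simp add: mem)
  have finE: "finite E" by (simp add: E_def)
  have "lead_coeff (P ^ d) \<noteq> 0" using P0 by (auto simp: lead_coeff_power)
  then have E0n: "0 \<in> E" "n \<in> E" using Q0 degQ by (auto simp: mem)
  define a where "a = Min (E - {0})"
  define c where "c = Max (E - {n})"
  have "n \<in> E - {0}" "0 \<in> E - {n}" using E0n n by auto
  then have ne: "E - {0} \<noteq> {}" "E - {n} \<noteq> {}" by blast+
  have "a \<in> E - {0}"
    unfolding a_def by (rule Min_in[OF _ ne(1)]) (simp add: finE)
  moreover have "c \<in> E - {n}"
    unfolding c_def by (rule Max_in[OF _ ne(2)]) (simp add: finE)
  ultimately have a: "a \<in> E" "0 < a" and c: "c \<in> E" "c < n"
    using le[of c] by auto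
  have a_le: "a \<le> i" if "i \<in> E" "0 < i" for i
    unfolding a_def using that finE by (intro Min_le) auto
  have le_c: "i \<le> c" if "i \<in> E" "i < n" for i
    unfolding c_def using that finE by (intro Max_ge) auto
  show ?thesis
  proof (cases "\<exists>i\<in>E. 0 < i \<and> i \<le> N \<and> i \<noteq> a")
    case False
    then have "\<exists>p. P = pcompose p (monom 1 a) \<and> sparse_root d p"
      by (intro low_gap_root d P0 assms(3) card) (use a in \<open>auto simp: mem N_def\<close>)
    then show ?thesis using a by blast
  next
    case True
    then obtain i where i: "i \<in> E" "0 < i" "i \<le> N" "i \<noteq> a" by blast
    show ?thesis
    proof (cases "\<exists>j\<in>E. n - N \<le> j \<and> j < n \<and> j \<noteq> c")
      case False
      have R0: "coeff (reversal P) 0 = 1" by (rule coeff_0_reversal[OF P0])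
      have degR: "degree (reversal P) = N" by (simp add: degree_reversal[OF P0] N_def)
      have "reversal (P ^ d) = reversal P ^ d" by (rule reversal_power[OF P0])
      then have exps: "exponents (reversal P ^ d) = (\<lambda>i. n - i) ` E"
        using exponents_reversal[OF Q0] degQ by (simp add: E_def)
      have memR: "coeff (reversal P ^ d) i \<noteq> 0 \<longleftrightarrow> i \<le> n \<and> n - i \<in> E" for i
      proof -
        have "coeff (reversal P ^ d) i \<noteq> 0 \<longleftrightarrow> i \<in> (\<lambda>i. n - i) ` E"
          unfolding exps[symmetric] by (simp add: exponents_def)
        also have "\<dots> \<longleftrightarrow> i \<le> n \<and> n - i \<in> E"
        proof
          assume "i \<in> (\<lambda>i. n - i) ` E"
          then obtain j where "j \<in> E" "i = n - j" by blast
          then show "i \<le> n \<and> n - i \<in> E" using le[of j] by simp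
        next
          assume "i \<le> n \<and> n - i \<in> E"
          then show "i \<in> (\<lambda>i. n - i) ` E" by (intro image_eqI[of _ _ "n - i"]) simp_all
        qed
        finally show ?thesis .
      qed
      have "\<exists>p. reversal P = pcompose p (monom 1 (n - c)) \<and> sparse_root d p"
      proof (rule low_gap_root[OF d R0])
        show "0 < degree (reversal P)" "0 < n - c" using degR n c by auto
        show "coeff (reversal P ^ d) (n - c) \<noteq> 0" using c by (simp add: memR)
        show "card (exponents (reversal P ^ d)) \<le> 5"
          unfolding exps by (rule order_trans[OF card_image_le[OF finE]]) (use card in \<open>simp add: E_def\<close>)
        fix i assume i: "0 < i" "i \<le> degree (reversal P)" "i \<noteq> n - c"
        show "coeff (reversal P ^ d) i = 0"
        proof (rule ccontr)
          assume "coeff (reversal P ^ d) i \<noteq> 0"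
          then have "i \<le> n" "n - i \<in> E" by (auto simp: memR)
          then have "n - i = c" using False i degR n by simp
          then show False using i(3) \<open>i \<le> n\<close> by simp
        qed
      qed
      then obtain p where p: "reversal P = pcompose p (monom 1 (n - c))" "sparse_root d p" by blast
      have "P = pcompose (reversal p) (monom 1 (n - c))"
        using reversal_reversal[OF P0] reversal_pcompose_monom[of "n - c" p] p c by simp
      then show ?thesis using sparse_root_reversal[OF p(2)] c zero_less_diff[of n c] by blast
    next
      case True
      then obtain j where j: "j \<in> E" "n - N \<le> j" "j < n" "j \<noteq> c" by blast
      note central = i j
      have "a < i" "j < c" using central a_le[of i] le_c[of j] by auto
      have "i = j"
      proof (rule ccontr)
        assume "i \<noteq> j"
        then have "i < j" using central n by linarith
        then have "card {0, a, i, j, c, n} = 6"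
          using a(2) c(2) \<open>a < i\<close> \<open>j < c\<close> by simp
        moreover have "card {0, a, i, j, c, n} \<le> card E"
          by (rule card_mono[OF finE]) (use a c central E0n in auto)
        ultimately show False using card by (simp add: E_def)
      qed
      then have "n = 2 * N" "i = N" using central n by linarith+
      then have "d = 2" using n by (simp add: n_def)
      have sub: "{0, a, N, c, 2 * N} \<subseteq> E"
        using a c central E0n \<open>n = 2 * N\<close> \<open>i = N\<close> by auto
      have "card {0, a, N, c, 2 * N} = 5"
        using a(2) c(2) \<open>a < i\<close> \<open>j < c\<close> \<open>i = j\<close> \<open>i = N\<close> \<open>n = 2 * N\<close> by simp
      then have "E = {0, a, N, c, 2 * N}"
        using card_seteq[OF finE sub] card by (simp add: E_def)
      then have "\<exists>p. P = pcompose p (monom 1 a) \<and> sparse_root 2 p"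
        using a(2) c(2) \<open>a < i\<close> \<open>j < c\<close> \<open>i = j\<close> \<open>i = N\<close> \<open>n = 2 * N\<close> \<open>d = 2\<close>
        by (intro central_root[of P a c] P0) (auto simp: N_def E_def)
      then show ?thesis using a(2) \<open>d = 2\<close> by blast
    qed
  qed
qed

section \<open>Reading off the exponents and coefficients\<close>

text \<open>The exponents are given as a strictly increasing list because two such lists with the same set of
elements are equal: this identifies the \<open>l i\<close> once the power is known explicitly.\<close>

lemma exponents_one_plus_monoms:
  fixes \<xi> :: "nat \<Rightarrow> 'a::field_char_0"
  assumes "\<forall>i\<in>{1..n}. \<xi> i \<noteq> 0" "\<forall>i\<in>{1..n}. 0 < l i" "strict_mono_on {1..n} l"
    and Q: "Q = 1 + (\<Sum>i=1..n. monom (\<xi> i) (l i))"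
  shows "exponents Q = set (0 # map l [1..<Suc n])"
    and "sorted_wrt (<) (0 # map l [1..<Suc n])"
    and "i \<in> {1..n} \<Longrightarrow> coeff Q (l i) = \<xi> i"
proof -
  have inj: "inj_on l {1..n}" using assms(3) by (rule strict_mono_on_imp_inj_on)
  have Qc: "coeff Q m = (if m = 0 then 1 else 0) + (\<Sum>j=1..n. if l j = m then \<xi> j else 0)" for m
    by (simp add: Q coeff_sum coeff_monom)
  have at_l: "coeff Q (l i) = \<xi> i" if "i \<in> {1..n}" for i
  proof -
    have "(\<Sum>j=1..n. if l j = l i then \<xi> j else 0) = (\<Sum>j=1..n. if j = i then \<xi> j else 0)"
      by (rule sum.cong) (use inj that in \<open>auto dest: inj_onD\<close>)
    then show ?thesis using that assms(2) by (simp add: Qc)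
  qed
  then show "i \<in> {1..n} \<Longrightarrow> coeff Q (l i) = \<xi> i" .
  have at_0: "coeff Q 0 = 1"
  proof -
    have "(\<Sum>j=1..n. if l j = 0 then \<xi> j else 0) = 0"
      by (rule sum.neutral) (use assms(2) in auto)
    then show ?thesis by (simp add: Qc)
  qed
  have "coeff Q m = 0" if "m \<noteq> 0" "m \<notin> l ` {1..n}" for m
    using that by (auto simp: Qc intro!: sum.neutral)
  moreover have "set (0 # map l [1..<Suc n]) = insert 0 (l ` {1..n})" by auto
  ultimately show "exponents Q = set (0 # map l [1..<Suc n])"
    using at_0 at_l assms(1) by (auto simp: exponents_def)
  show "sorted_wrt (<) (0 # map l [1..<Suc n])"
    using assms(2,3) by (auto simp: sorted_wrt_map strict_mono_on_def
        intro!: sorted_wrt_mono_rel[OF _ sorted_wrt_upt] simp del: upt_Suc)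
qed

lemma exponents_Poly: "exponents (Poly cs) = set (filter (\<lambda>i. cs ! i \<noteq> 0) [0..<length cs])"
  by (auto simp: exponents_def nth_default_def)

lemma pcompose_monom_simps:
  fixes \<alpha> :: "'a::comm_ring_1"
  shows "pcompose [:1, \<alpha>:] (monom 1 a) = 1 + monom \<alpha> a"
    and "pcompose [:1, \<alpha>, \<beta>:] (monom 1 a) = 1 + monom \<alpha> a + monom \<beta> (2 * a)"
    and "pcompose [:1, \<alpha>, \<beta>, \<gamma>:] (monom 1 a)
      = 1 + monom \<alpha> a + monom \<beta> (2 * a) + monom \<gamma> (3 * a)"
    and "pcompose [:1, \<alpha>, \<beta>, \<gamma>, \<delta>:] (monom 1 a)
      = 1 + monom \<alpha> a + monom \<beta> (2 * a) + monom \<gamma> (3 * a) + monom \<delta> (4 * a)"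
  by (simp_all add: pcompose_pCons mult_monom smult_monom distrib_left eval_nat_numeral add_ac)

theorem proposition5:
  fixes d k :: nat
    and \<xi> :: "nat \<Rightarrow> complex"
    and l :: "nat \<Rightarrow> nat"
    and P :: "complex poly"
  assumes "2 \<le> d"
    and "1 \<le> k" and "k \<le> 5"
    and "\<forall>i\<in>{1..k - 1}. \<xi> i \<noteq> 0"
    and "\<forall>i\<in>{1..k - 1}. 0 < l i"
    and "strict_mono_on {1..k - 1} l"
    and "poly P 0 = 1"
    and "P ^ d = 1 + (\<Sum>i=1..k - 1. monom (\<xi> i) (l i))"
  shows
    "(k = 5 \<longrightarrow>
        (d = 4 \<and> l 2 = 2 * l 1 \<and> l 3 = 3 * l 1 \<and> l 4 = 4 * l 1 \<and>
         \<xi> 2 = 3/8 * \<xi> 1 ^ 2 \<and> \<xi> 3 = 1/16 * \<xi> 1 ^ 3 \<and> \<xi> 4 = 1/256 * \<xi> 1 ^ 4 \<and>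
         P = 1 + monom (1/4 * \<xi> 1) (l 1))
      \<or> (d = 3 \<and> l 2 = 3 * l 1 \<and> l 3 = 5 * l 1 \<and> l 4 = 6 * l 1 \<and>
         \<xi> 2 = - (5/27) * \<xi> 1 ^ 3 \<and> \<xi> 3 = 1/81 * \<xi> 1 ^ 5 \<and> \<xi> 4 = - (1/729) * \<xi> 1 ^ 6 \<and>
         P = 1 + monom (1/3 * \<xi> 1) (l 1) - monom (1/9 * \<xi> 1 ^ 2) (2 * l 1))
      \<or> (d = 2 \<and> l 2 = 4 * l 1 \<and> l 3 = 5 * l 1 \<and> l 4 = 6 * l 1 \<and>
         \<xi> 2 = 5/64 * \<xi> 1 ^ 4 \<and> \<xi> 3 = - (1/64) * \<xi> 1 ^ 5 \<and> \<xi> 4 = 1/256 * \<xi> 1 ^ 6 \<and>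
         P = 1 + monom (1/2 * \<xi> 1) (l 1) - monom (1/8 * \<xi> 1 ^ 2) (2 * l 1)
               + monom (1/16 * \<xi> 1 ^ 3) (3 * l 1))
      \<or> (d = 2 \<and> l 2 = 3 * l 1 \<and> l 3 = 5 * l 1 \<and> l 4 = 6 * l 1 \<and>
         \<xi> 2 = - (5/32) * \<xi> 1 ^ 3 \<and> \<xi> 3 = 1/256 * \<xi> 1 ^ 5 \<and> \<xi> 4 = 1/4096 * \<xi> 1 ^ 6 \<and>
         P = 1 + monom (1/2 * \<xi> 1) (l 1) - monom (1/8 * \<xi> 1 ^ 2) (2 * l 1)
               - monom (1/64 * \<xi> 1 ^ 3) (3 * l 1))
      \<or> (d = 2 \<and> l 2 = 4 * l 1 \<and> l 3 = 7 * l 1 \<and> l 4 = 8 * l 1 \<and>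
         \<xi> 2 = 7/64 * \<xi> 1 ^ 4 \<and> \<xi> 3 = 1/512 * \<xi> 1 ^ 7 \<and> \<xi> 4 = 1/4096 * \<xi> 1 ^ 8 \<and>
         P = 1 + monom (1/2 * \<xi> 1) (l 1) - monom (1/8 * \<xi> 1 ^ 2) (2 * l 1)
               + monom (1/16 * \<xi> 1 ^ 3) (3 * l 1) + monom (1/64 * \<xi> 1 ^ 4) (4 * l 1))
      \<or> (d = 2 \<and> l 2 = 2 * l 1 \<and> l 3 = 5 * l 1 \<and> l 4 = 6 * l 1 \<and>
         \<xi> 2 = 5/4 * \<xi> 1 ^ 2 \<and> \<xi> 3 = - (1/4) * \<xi> 1 ^ 5 \<and> \<xi> 4 = 1/16 * \<xi> 1 ^ 6 \<and>
         P = 1 + monom (1/2 * \<xi> 1) (l 1) + monom (1/2 * \<xi> 1 ^ 2) (2 * l 1)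
               - monom (1/4 * \<xi> 1 ^ 3) (3 * l 1))
      \<or> (d = 2 \<and> l 2 = 2 * l 1 \<and> l 3 = 3 * l 1 \<and> l 4 = 4 * l 1 \<and>
         \<xi> 3 = - (1/8) * \<xi> 1 ^ 3 + 1/2 * \<xi> 1 * \<xi> 2 \<and>
         \<xi> 4 = (- (1/8) * \<xi> 1 ^ 2 + 1/2 * \<xi> 2) ^ 2 \<and>
         P = 1 + monom (1/2 * \<xi> 1) (l 1) + monom (1/2 * \<xi> 2 - 1/8 * \<xi> 1 ^ 2) (2 * l 1)))
   \<and> (k = 4 \<longrightarrow>
        (d = 2 \<and> l 2 = 3 * l 1 \<and> l 3 = 4 * l 1 \<and>
         \<xi> 2 = - (1/8) * \<xi> 1 ^ 3 \<and> \<xi> 3 = 1/64 * \<xi> 1 ^ 4 \<and>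
         P = 1 + monom (1/2 * \<xi> 1) (l 1) - monom (1/8 * \<xi> 1 ^ 2) (2 * l 1))
      \<or> (d = 3 \<and> l 2 = 2 * l 1 \<and> l 3 = 3 * l 1 \<and>
         \<xi> 2 = 1/3 * \<xi> 1 ^ 2 \<and> \<xi> 3 = 1/27 * \<xi> 1 ^ 3 \<and>
         P = 1 + monom (1/3 * \<xi> 1) (l 1)))
   \<and> (k = 3 \<longrightarrow>
        d = 2 \<and> l 2 = 2 * l 1 \<and> \<xi> 2 = 1/4 * \<xi> 1 ^ 2 \<and>
        P = 1 + monom (1/2 * \<xi> 1) (l 1))"
proof -
  define n where "n = k - 1"
  define Q where "Q = P ^ d"
  note sparse = assms(4-6)[folded n_def] assms(8)[folded n_def Q_def]
  note Q = exponents_one_plus_monoms[OF sparse]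
  have P0: "coeff P 0 = 1" using assms(7) by (simp add: poly_0_coeff_0)
  show ?thesis
  proof (cases "3 \<le> k")
    case False
    then show ?thesis by auto
  next
    case True
    have "card (exponents Q) = k"
      unfolding Q(1) using distinct_card[OF strict_sorted_iff[THEN iffD1, OF Q(2), THEN conjunct2]]
        True by (simp add: n_def del: upt_Suc)
    then have card: "card (exponents (P ^ d)) \<le> 5" using assms(3) by (simp add: Q_def)
    have "0 < degree P"
    proof (rule ccontr)
      assume "\<not> 0 < degree P"
      then have "P = 1" using P0 by (metis degree_eq_zeroE gr0I lead_coeff_pCons(2) one_pCons
            coeff_pCons_0)
      then have "exponents Q \<subseteq> {0}" by (auto simp: Q_def exponents_def)
      then show False using \<open>card (exponents Q) = k\<close> True card_mono[of "{0}" "exponents Q"] by simp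
    qed
    then obtain a p where a: "0 < a" and P: "P = pcompose p (monom 1 a)" and p: "sparse_root d p"
      using sparse_power_root[OF assms(1) P0 _ card] by blast
    have Q_p: "Q = pcompose (p ^ d) (monom 1 a)" by (simp add: Q_def P pcompose_power)
    \<comment> \<open>the nonzero positions in an explicit coefficient list of \<open>p ^ d\<close>, scaled by \<open>a\<close>, are the
      exponents in increasing order; this also determines \<open>k\<close>\<close>
    have key: "0 # map l [1..<k] = map ((*) a) (filter (\<lambda>i. cs ! i \<noteq> 0) [0..<length cs])"
      if "p ^ d = Poly cs" for cs
    proof (rule strict_sorted_equal)
      show "sorted_wrt (<) (0 # map l [1..<k])" using Q(2) True by (simp add: n_def)
      show "sorted_wrt (<) (map ((*) a) (filter (\<lambda>i. cs ! i \<noteq> 0) [0..<length cs]))"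
        using a by (auto simp: sorted_wrt_map intro!: sorted_wrt_filter)
      show "set (0 # map l [1..<k]) = set (map ((*) a) (filter (\<lambda>i. cs ! i \<noteq> 0) [0..<length cs]))"
        using Q(1) exponents_pcompose_monom[OF a, of "p ^ d"] exponents_Poly[of cs] that True
        by (simp add: n_def Q_p)
    qed
    have xi: "\<xi> i = nth_default 0 cs m"
      if "p ^ d = Poly cs" "l i = a * m" "1 \<le> i" "i < k" for cs i m
      using Q(3)[of i] that a by (simp add: Q_p coeff_pcompose_monom n_def)
    show ?thesis
      using p
    proof cases
      case (linear \<alpha>)
      consider "d = 2" | "d = 3" | "d = 4" using linear(3) by auto
      then show ?thesis
      proof cases
        case 1
        have pw: "p ^ d = Poly [1, 2 * \<alpha>, \<alpha> ^ 2]"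
          unfolding linear(1) 1 by (simp add: eval_nat_numeral algebra_simps)
        have K: "0 # map l [1..<k] = [0, a, 2 * a]"
          using key[OF pw] linear(2) by (simp add: eval_nat_numeral)
        have k: "k = 3"
          using arg_cong[OF K, of length] by simp
        have l: "l 1 = a" "l 2 = 2 * a"
          using K unfolding k by (simp_all add: eval_nat_numeral)
        have "P = 1 + monom \<alpha> a"
          unfolding P linear(1) pcompose_monom_simps by simp
        moreover have "\<xi> 1 = 2 * \<alpha>" "\<xi> 2 = \<alpha> ^ 2"
          using xi[OF pw, of 1 1] xi[OF pw, of 2 2] l
          unfolding k by (simp_all add: nth_default_def)
        ultimately show ?thesis
          using l k 1 by (simp add: field_simps power_mult_distrib eval_nat_numeral)
      next
        case 2
        have pw: "p ^ d = Poly [1, 3 * \<alpha>, 3 * \<alpha> ^ 2, \<alpha> ^ 3]"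
          unfolding linear(1) 2 by (simp add: eval_nat_numeral algebra_simps)
        have K: "0 # map l [1..<k] = [0, a, 2 * a, 3 * a]"
          using key[OF pw] linear(2) by (simp add: eval_nat_numeral)
        have k: "k = 4"
          using arg_cong[OF K, of length] by simp
        have l: "l 1 = a" "l 2 = 2 * a" "l 3 = 3 * a"
          using K unfolding k by (simp_all add: eval_nat_numeral)
        have "P = 1 + monom \<alpha> a"
          unfolding P linear(1) pcompose_monom_simps by simp
        moreover have "\<xi> 1 = 3 * \<alpha>" "\<xi> 2 = 3 * \<alpha> ^ 2" "\<xi> 3 = \<alpha> ^ 3"
          using xi[OF pw, of 1 1] xi[OF pw, of 2 2] xi[OF pw, of 3 3] l
          unfolding k by (simp_all add: nth_default_def)
        ultimately show ?thesis
          using l k 2 by (simp add: field_simps power_mult_distrib eval_nat_numeral)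
      next
        case 3
        have pw: "p ^ d = Poly [1, 4 * \<alpha>, 6 * \<alpha> ^ 2, 4 * \<alpha> ^ 3, \<alpha> ^ 4]"
          unfolding linear(1) 3 by (simp add: eval_nat_numeral algebra_simps)
        have K: "0 # map l [1..<k] = [0, a, 2 * a, 3 * a, 4 * a]"
          using key[OF pw] linear(2) by (simp add: eval_nat_numeral)
        have k: "k = 5"
          using arg_cong[OF K, of length] by simp
        have l: "l 1 = a" "l 2 = 2 * a" "l 3 = 3 * a" "l 4 = 4 * a"
          using K unfolding k by (simp_all add: eval_nat_numeral)
        have "P = 1 + monom \<alpha> a"
          unfolding P linear(1) pcompose_monom_simps by simp
        moreover have "\<xi> 1 = 4 * \<alpha>" "\<xi> 2 = 6 * \<alpha> ^ 2" "\<xi> 3 = 4 * \<alpha> ^ 3" "\<xi> 4 = \<alpha> ^ 4"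
          using xi[OF pw, of 1 1] xi[OF pw, of 2 2] xi[OF pw, of 3 3] xi[OF pw, of 4 4] l
          unfolding k by (simp_all add: nth_default_def)
        ultimately show ?thesis
          using l k 3 by (simp add: field_simps power_mult_distrib eval_nat_numeral)
      qed
    next
      case (quadratic_square \<alpha> \<beta>)
      show ?thesis
      \<comment> \<open>the coefficient at \<open>2 * a\<close> decides between four and five terms\<close>
      proof (cases "\<alpha> ^ 2 + 2 * \<beta> = 0")
        case True
        then have \<beta>: "\<beta> = - (\<alpha> ^ 2 / 2)"
          by (simp add: eq_neg_iff_add_eq_0 field_simps)
        have pw: "p ^ d = Poly [1, 2 * \<alpha>, \<alpha> ^ 2 + 2 * \<beta>, 2 * \<alpha> * \<beta>, \<beta> ^ 2]"
          unfolding quadratic_square(2) quadratic_square(1) by (simp add: eval_nat_numeral algebra_simps)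
        have K: "0 # map l [1..<k] = [0, a, 3 * a, 4 * a]"
          using key[OF pw] quadratic_square(3,4) True by (simp add: eval_nat_numeral)
        have k: "k = 4"
          using arg_cong[OF K, of length] by simp
        have l: "l 1 = a" "l 2 = 3 * a" "l 3 = 4 * a"
          using K unfolding k by (simp_all add: eval_nat_numeral)
        have "P = 1 + monom \<alpha> a - monom (\<alpha> ^ 2 / 2) (2 * a)"
          unfolding P quadratic_square(2) pcompose_monom_simps by (simp add: \<beta> minus_monom[symmetric])
        moreover have "\<xi> 1 = 2 * \<alpha>" "\<xi> 2 = 2 * \<alpha> * \<beta>" "\<xi> 3 = \<beta> ^ 2"
          using xi[OF pw, of 1 1] xi[OF pw, of 2 3] xi[OF pw, of 3 4] l
          unfolding k by (simp_all add: nth_default_def)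
        ultimately show ?thesis
          using l k quadratic_square(1) True \<beta> by (simp add: field_simps power_mult_distrib eval_nat_numeral)
      next
        case False
        have pw: "p ^ d = Poly [1, 2 * \<alpha>, \<alpha> ^ 2 + 2 * \<beta>, 2 * \<alpha> * \<beta>, \<beta> ^ 2]"
          unfolding quadratic_square(2) quadratic_square(1) by (simp add: eval_nat_numeral algebra_simps)
        have K: "0 # map l [1..<k] = [0, a, 2 * a, 3 * a, 4 * a]"
          using key[OF pw] quadratic_square(3,4) False by (simp add: eval_nat_numeral)
        have k: "k = 5"
          using arg_cong[OF K, of length] by simp
        have l: "l 1 = a" "l 2 = 2 * a" "l 3 = 3 * a" "l 4 = 4 * a"
          using K unfolding k by (simp_all add: eval_nat_numeral)
        have "P = 1 + monom \<alpha> a + monom \<beta> (2 * a)"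
          unfolding P quadratic_square(2) pcompose_monom_simps by simp
        moreover have "\<xi> 1 = 2 * \<alpha>" "\<xi> 2 = \<alpha> ^ 2 + 2 * \<beta>" "\<xi> 3 = 2 * \<alpha> * \<beta>" "\<xi> 4 = \<beta> ^ 2"
          using xi[OF pw, of 1 1] xi[OF pw, of 2 2] xi[OF pw, of 3 3] xi[OF pw, of 4 4] l
          unfolding k by (simp_all add: nth_default_def)
        ultimately show ?thesis
          using l k quadratic_square(1) by (simp add: field_simps power_mult_distrib eval_nat_numeral)
      qed
    next
      case (quadratic_cube \<alpha>)
      have pw: "p ^ d = Poly [1, 3 * \<alpha>, 0, - (5 * \<alpha> ^ 3), 0, 3 * \<alpha> ^ 5, - (\<alpha> ^ 6)]"
        unfolding quadratic_cube(2) quadratic_cube(1) by (simp add: eval_nat_numeral algebra_simps)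
      have K: "0 # map l [1..<k] = [0, a, 3 * a, 5 * a, 6 * a]"
        using key[OF pw] quadratic_cube(3) by (simp add: eval_nat_numeral)
      have k: "k = 5"
        using arg_cong[OF K, of length] by simp
      have l: "l 1 = a" "l 2 = 3 * a" "l 3 = 5 * a" "l 4 = 6 * a"
        using K unfolding k by (simp_all add: eval_nat_numeral)
      have "P = 1 + monom \<alpha> a - monom (\<alpha> ^ 2) (2 * a)"
        unfolding P quadratic_cube(2) pcompose_monom_simps by (simp add: minus_monom[symmetric])
      moreover have "\<xi> 1 = 3 * \<alpha>" "\<xi> 2 = - (5 * \<alpha> ^ 3)" "\<xi> 3 = 3 * \<alpha> ^ 5" "\<xi> 4 = - (\<alpha> ^ 6)"
        using xi[OF pw, of 1 1] xi[OF pw, of 2 3] xi[OF pw, of 3 5] xi[OF pw, of 4 6] l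
        unfolding k by (simp_all add: nth_default_def)
      ultimately show ?thesis
        using l k quadratic_cube(1) by (simp add: field_simps power_mult_distrib eval_nat_numeral)
    next
      case (cubic_low \<alpha>)
      have pw: "p ^ d = Poly [1, 2 * \<alpha>, 0, 0, 5 / 4 * \<alpha> ^ 4, - (\<alpha> ^ 5 / 2), \<alpha> ^ 6 / 4]"
        unfolding cubic_low(2) cubic_low(1) by (simp add: eval_nat_numeral algebra_simps)
      have K: "0 # map l [1..<k] = [0, a, 4 * a, 5 * a, 6 * a]"
        using key[OF pw] cubic_low(3) by (simp add: eval_nat_numeral)
      have k: "k = 5"
        using arg_cong[OF K, of length] by simp
      have l: "l 1 = a" "l 2 = 4 * a" "l 3 = 5 * a" "l 4 = 6 * a"
        using K unfolding k by (simp_all add: eval_nat_numeral)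
      have "P = 1 + monom \<alpha> a - monom (\<alpha> ^ 2 / 2) (2 * a) + monom (\<alpha> ^ 3 / 2) (3 * a)"
        unfolding P cubic_low(2) pcompose_monom_simps by (simp add: minus_monom[symmetric])
      moreover have "\<xi> 1 = 2 * \<alpha>" "\<xi> 2 = 5 / 4 * \<alpha> ^ 4" "\<xi> 3 = - (\<alpha> ^ 5 / 2)" "\<xi> 4 = \<alpha> ^ 6 / 4"
        using xi[OF pw, of 1 1] xi[OF pw, of 2 4] xi[OF pw, of 3 5] xi[OF pw, of 4 6] l
        unfolding k by (simp_all add: nth_default_def)
      ultimately show ?thesis
        using l k cubic_low(1) by (simp add: field_simps power_mult_distrib eval_nat_numeral)
    next
      case (cubic_high \<alpha>)
      have pw: "p ^ d = Poly [1, 2 * \<alpha>, 5 * \<alpha> ^ 2, 0, 0, - (8 * \<alpha> ^ 5), 4 * \<alpha> ^ 6]"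
        unfolding cubic_high(2) cubic_high(1) by (simp add: eval_nat_numeral algebra_simps)
      have K: "0 # map l [1..<k] = [0, a, 2 * a, 5 * a, 6 * a]"
        using key[OF pw] cubic_high(3) by (simp add: eval_nat_numeral)
      have k: "k = 5"
        using arg_cong[OF K, of length] by simp
      have l: "l 1 = a" "l 2 = 2 * a" "l 3 = 5 * a" "l 4 = 6 * a"
        using K unfolding k by (simp_all add: eval_nat_numeral)
      have "P = 1 + monom \<alpha> a + monom (2 * \<alpha> ^ 2) (2 * a) - monom (2 * \<alpha> ^ 3) (3 * a)"
        unfolding P cubic_high(2) pcompose_monom_simps by (simp add: minus_monom[symmetric])
      moreover have "\<xi> 1 = 2 * \<alpha>" "\<xi> 2 = 5 * \<alpha> ^ 2" "\<xi> 3 = - (8 * \<alpha> ^ 5)" "\<xi> 4 = 4 * \<alpha> ^ 6"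
        using xi[OF pw, of 1 1] xi[OF pw, of 2 2] xi[OF pw, of 3 5] xi[OF pw, of 4 6] l
        unfolding k by (simp_all add: nth_default_def)
      ultimately show ?thesis
        using l k cubic_high(1) by (simp add: field_simps power_mult_distrib eval_nat_numeral)
    next
      case (cubic_central \<alpha>)
      have pw: "p ^ d = Poly [1, 2 * \<alpha>, 0, - (5 / 4 * \<alpha> ^ 3), 0, \<alpha> ^ 5 / 8, \<alpha> ^ 6 / 64]"
        unfolding cubic_central(2) cubic_central(1) by (simp add: eval_nat_numeral algebra_simps)
      have K: "0 # map l [1..<k] = [0, a, 3 * a, 5 * a, 6 * a]"
        using key[OF pw] cubic_central(3) by (simp add: eval_nat_numeral)
      have k: "k = 5"
        using arg_cong[OF K, of length] by simp
      have l: "l 1 = a" "l 2 = 3 * a" "l 3 = 5 * a" "l 4 = 6 * a"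
        using K unfolding k by (simp_all add: eval_nat_numeral)
      have "P = 1 + monom \<alpha> a - monom (\<alpha> ^ 2 / 2) (2 * a) - monom (\<alpha> ^ 3 / 8) (3 * a)"
        unfolding P cubic_central(2) pcompose_monom_simps by (simp add: minus_monom[symmetric])
      moreover have "\<xi> 1 = 2 * \<alpha>" "\<xi> 2 = - (5 / 4 * \<alpha> ^ 3)" "\<xi> 3 = \<alpha> ^ 5 / 8" "\<xi> 4 = \<alpha> ^ 6 / 64"
        using xi[OF pw, of 1 1] xi[OF pw, of 2 3] xi[OF pw, of 3 5] xi[OF pw, of 4 6] l
        unfolding k by (simp_all add: nth_default_def)
      ultimately show ?thesis
        using l k cubic_central(1) by (simp add: field_simps power_mult_distrib eval_nat_numeral)
    next
      case (quartic \<alpha>)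
      have pw: "p ^ d = Poly [1, 2 * \<alpha>, 0, 0, 7 / 4 * \<alpha> ^ 4, 0, 0, \<alpha> ^ 7 / 4, \<alpha> ^ 8 / 16]"
        unfolding quartic(2) quartic(1) by (simp add: eval_nat_numeral algebra_simps)
      have K: "0 # map l [1..<k] = [0, a, 4 * a, 7 * a, 8 * a]"
        using key[OF pw] quartic(3) by (simp add: eval_nat_numeral)
      have k: "k = 5"
        using arg_cong[OF K, of length] by simp
      have l: "l 1 = a" "l 2 = 4 * a" "l 3 = 7 * a" "l 4 = 8 * a"
        using K unfolding k by (simp_all add: eval_nat_numeral)
      have "P = 1 + monom \<alpha> a - monom (\<alpha> ^ 2 / 2) (2 * a) + monom (\<alpha> ^ 3 / 2) (3 * a) + monom (\<alpha> ^ 4 / 4) (4 * a)"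
        unfolding P quartic(2) pcompose_monom_simps by (simp add: minus_monom[symmetric])
      moreover have "\<xi> 1 = 2 * \<alpha>" "\<xi> 2 = 7 / 4 * \<alpha> ^ 4" "\<xi> 3 = \<alpha> ^ 7 / 4" "\<xi> 4 = \<alpha> ^ 8 / 16"
        using xi[OF pw, of 1 1] xi[OF pw, of 2 4] xi[OF pw, of 3 7] xi[OF pw, of 4 8] l
        unfolding k by (simp_all add: nth_default_def)
      ultimately show ?thesis
        using l k quartic(1) by (simp add: field_simps power_mult_distrib eval_nat_numeral)
    qed
  qed
qed

end
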